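(* Consider a charged three-body system with masses $m_1,m_2,m_3>0$ and coupling constants $\alpha_1,\alpha_2,\alpha_3\in\mathbb{R}$. Let $r>0$ be the magnitude of the angular momentum and $E\neq 0$ the energy. For a shape-orientation point $(\tilde q,\tilde{\mathbf J})\in\tilde{\mathcal Q}\times S^2_1$ let $$F(\lambda)=\lambda^2E-\frac{r^2}{2}\,\tilde{\mathbf J}\cdot[\tilde{\mathbf M}(\tilde q)]^{-1}\cdot\tilde{\mathbf J}-\lambda\,\tilde V(\tilde q),$$ $$\Delta=4E\,E_R+\tilde V(\tilde q)^2,\qquad E_R=\frac{r^2}{2}\,\tilde{\mathbf J}\cdot[\tilde{\mathbf M}(\tilde q)]^{-1}\cdot\tilde{\mathbf J},$$ and let $$\lambda_\pm=\frac{\tilde V(\tilde q)}{2E}\pm\sqrt{\frac{\Delta}{4E^2}}$$ be the (possibly complex) roots of $F$. Then: 1. If $E>0$, every shape-orientation point belongs to the Hill region for $(E,r)$. 2. If $E<0$, a shape $\tilde q$ with $\tilde V(\tilde q)>0$ is for no orientation in the Hill region, i.e. $(\tilde q,\tilde{\mathbf J})$ is not in the Hill region for $(E,r)$ for any $\tilde{\mathbf J}\in S^2_1$. 3. If $E<0$, a shape-orientation point $(\tilde q,\tilde{\mathbf J})$ with $\tilde V(\tilde q)<0$ is in the Hill region for $(E,r)$ if and only if the roots $\lambda_\pm$ are real.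
   Context: Setting: three bodies with masses $m_1,m_2,m_3>0$ and positions $\mathbf x_1,\mathbf x_2,\mathbf x_3\in\mathbb{R}^3$, with Hamiltonian equal to kinetic energy plus the potential $$V=-\frac{\alpha_3}{r_{12}}-\frac{\alpha_2}{r_{13}}-\frac{\alpha_1}{r_{23}},\qquad r_{ij}=\|\mathbf x_i-\mathbf x_j\|,\quad \alpha_k\in\mathbb{R}.$$ Mass-weighted Jacobi vectors: $\mathbf s_1=\sqrt{\mu_1}(\mathbf x_1-\mathbf x_3)$, $\mathbf s_2=\sqrt{\mu_2}\big(\mathbf x_2-\frac{m_1\mathbf x_1+m_3\mathbf x_3}{m_1+m_3}\big)$ with $\mu_1=\frac{m_1m_3}{m_1+m_3}$, $\mu_2=\frac{m_2(m_1+m_3)}{m_1+m_2+m_3}$. Internal space: the internal space $\mathcal Q$ is the quotient of the space of pairs $(\mathbf s_1,\mathbf s_2)\in\mathbb{R}^3\times\mathbb{R}^3$ by the diagonal action of $\mathrm{SO}(3)$. Its interior $\mathcal Q^{\mathrm o}$ consists of the non-collinear configurations and has smooth (Jacobi) coordinates $q=(\rho_1,\rho_2,\phi)$ with $\rho_i=\|\mathbf s_i\|>0$, $\mathbf s_1\cdot\mathbf s_2=\rho_1\rho_2\cos\phi$, $0<\phi<\pi$. A body frame is fixed by representing $q$ by $\mathbf r_1=(\rho_1,0,0)$, $\mathbf r_2=(\rho_2\cos\phi,\rho_2\sin\phi,0)$. The potential, depending only on the mutual distances, is a function $V(q)$: $r_{13}=\rho_1/\sqrt{\mu_1}$, $r_{12}=\big\|\frac{\mathbf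 r_2}{\sqrt{\mu_2}}-\frac{m_3}{m_1+m_3}\frac{\mathbf r_1}{\sqrt{\mu_1}}\big\|$, $r_{23}=\big\|\frac{\mathbf r_2}{\sqrt{\mu_2}}+\frac{m_1}{m_1+m_3}\frac{\mathbf r_1}{\sqrt{\mu_1}}\big\|$. Reduced Hamiltonian: with $\mathbf J\in\mathbb{R}^3$ the body angular momentum (the angular momentum $\mathbf L$ about the center of mass expressed in the body frame, so $\|\mathbf J\|=\|\mathbf L\|=r$) and $p=(p_{\rho_1},p_{\rho_2},p_\phi)\in\mathbb{R}^3$ the momenta conjugate to $q$, $$H(q,p,\mathbf J)=\tfrac12\mathbf J\cdot\mathbf M^{-1}\cdot\mathbf J+\tfrac12 g^{\mu\nu}(p_\mu-\mathbf J\cdot\mathbf A_\mu)(p_\nu-\mathbf J\cdot\mathbf A_\nu)+V(q),$$ (summation over repeated indices), where $$\mathbf M(q)=\begin{pmatrix}\rho_2^2\sin^2\phi&-\rho_2^2\sin\phi\cos\phi&0\\-\rho_2^2\sin\phi\cos\phi&\rho_1^2+\rho_2^2\cos^2\phi&0\\0&0&\rho_1^2+\rho_2^2\end{pmatrix}$$ is the moment of inertia tensor, $(g^{\mu\nu})$ is the inverse of $(g_{\mu\nu})=\mathrm{diag}\big(1,1,\frac{\rho_1^2\rho_2^2}{\rho_1^2+\rho_2^2}\big)$, $\mathbf A_{\rho_1}=\mathbf A_{\rho_2}=0$ and $\mathbf A_\phi=\big(0,0,\frac{\rho_2^2}{\rho_1^2+\rho_2^2}\big)$. Dilations, shapes and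 orientations: for $\lambda>0$, $d_\lambda(\rho_1,\rho_2,\phi)=(\lambda\rho_1,\lambda\rho_2,\phi)$. The shape space is $\tilde{\mathcal Q}=\{q\in\mathcal Q^{\mathrm o}: \rho_1^2+\rho_2^2=1\}$; its points $\tilde q$ are called shapes. $\tilde V$ and $\tilde{\mathbf M}$ denote the restrictions of $V$ and $\mathbf M$ to $\tilde{\mathcal Q}$. $S^2_1=\{\tilde{\mathbf J}\in\mathbb{R}^3:\|\tilde{\mathbf J}\|=1\}$ is the unit sphere of orientations (normalised body angular momenta). Points $(\tilde q,\tilde{\mathbf J})\in\tilde{\mathcal Q}\times S^2_1$ are called shape-orientation points. Hill region: for given energy $E\in\mathbb{R}$ and $r>0$, a shape-orientation point $(\tilde q,\tilde{\mathbf J})$ is in the Hill region (for $(E,r)$) if there exist $\lambda>0$ and $p\in\mathbb{R}^3$ such that $H(d_\lambda(\tilde q),p,r\tilde{\mathbf J})=E$. *)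

theory Defs
  imports "HOL-Analysis.Analysis"
begin

text \<open>
  Three-component data are vectors of type \<open>real ^ 3\<close>: masses \<open>m\<close>, coupling constants \<open>\<alpha>\<close>,
  Jacobi coordinates \<open>q = (\<rho>\<^sub>1, \<rho>\<^sub>2, \<phi>)\<close>, conjugate momenta \<open>p\<close>, body angular momenta \<open>J\<close>.
\<close>

definition mu1 :: "real ^ 3 \<Rightarrow> real" where
  "mu1 m = m $ 1 * m $ 3 / (m $ 1 + m $ 3)"

definition mu2 :: "real ^ 3 \<Rightarrow> real" where
  "mu2 m = m $ 2 * (m $ 1 + m $ 3) / (m $ 1 + m $ 2 + m $ 3)"

definition jacobi1 :: "real ^ 3 \<Rightarrow> real ^ 3 \<Rightarrow> real ^ 3 \<Rightarrow> real ^ 3 \<Rightarrow> real ^ 3" where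
  "jacobi1 m x1 x2 x3 = sqrt (mu1 m) *\<^sub>R (x1 - x3)"

definition jacobi2 :: "real ^ 3 \<Rightarrow> real ^ 3 \<Rightarrow> real ^ 3 \<Rightarrow> real ^ 3 \<Rightarrow> real ^ 3" where
  "jacobi2 m x1 x2 x3 =
     sqrt (mu2 m) *\<^sub>R (x2 - (1 / (m $ 1 + m $ 3)) *\<^sub>R (m $ 1 *\<^sub>R x1 + m $ 3 *\<^sub>R x3))"

text \<open>
  The interior of the internal space (non-collinear configurations modulo rotations), in its
  global Jacobi coordinates; that these are coordinates on the set of \<open>SO(3)\<close>-orbits is
  \<open>internal_space_orbits\<close> below.
\<close>

definition internal_space :: "(real ^ 3) set" where
  "internal_space = {q. q $ 1 > 0 \<and> q $ 2 > 0 \<and> 0 < q $ 3 \<and> q $ 3 < pi}"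

definition body1 :: "real ^ 3 \<Rightarrow> real ^ 3" where
  "body1 q = vector [q $ 1, 0, 0]"

definition body2 :: "real ^ 3 \<Rightarrow> real ^ 3" where
  "body2 q = vector [q $ 2 * cos (q $ 3), q $ 2 * sin (q $ 3), 0]"

definition r13 :: "real ^ 3 \<Rightarrow> real ^ 3 \<Rightarrow> real" where
  "r13 m q = q $ 1 / sqrt (mu1 m)"

definition r12 :: "real ^ 3 \<Rightarrow> real ^ 3 \<Rightarrow> real" where
  "r12 m q = norm ((1 / sqrt (mu2 m)) *\<^sub>R body2 q
                   - (m $ 3 / (m $ 1 + m $ 3)) *\<^sub>R ((1 / sqrt (mu1 m)) *\<^sub>R body1 q))"

definition r23 :: "real ^ 3 \<Rightarrow> real ^ 3 \<Rightarrow> real" where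
  "r23 m q = norm ((1 / sqrt (mu2 m)) *\<^sub>R body2 q
                   + (m $ 1 / (m $ 1 + m $ 3)) *\<^sub>R ((1 / sqrt (mu1 m)) *\<^sub>R body1 q))"

definition potential :: "real ^ 3 \<Rightarrow> real ^ 3 \<Rightarrow> real ^ 3 \<Rightarrow> real" where
  "potential m \<alpha> q = - (\<alpha> $ 3 / r12 m q) - \<alpha> $ 2 / r13 m q - \<alpha> $ 1 / r23 m q"

definition inertia :: "real ^ 3 \<Rightarrow> real ^ 3 ^ 3" where
  "inertia q = (let \<rho>1 = q $ 1; \<rho>2 = q $ 2; \<phi> = q $ 3 in
     vector [vector [\<rho>2\<^sup>2 * (sin \<phi>)\<^sup>2, - (\<rho>2\<^sup>2 * sin \<phi> * cos \<phi>), 0],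
             vector [- (\<rho>2\<^sup>2 * sin \<phi> * cos \<phi>), \<rho>1\<^sup>2 + \<rho>2\<^sup>2 * (cos \<phi>)\<^sup>2, 0],
             vector [0, 0, \<rho>1\<^sup>2 + \<rho>2\<^sup>2]])"

definition metric :: "real ^ 3 \<Rightarrow> real ^ 3 ^ 3" where
  "metric q = (let \<rho>1 = q $ 1; \<rho>2 = q $ 2 in
     vector [vector [1, 0, 0],
             vector [0, 1, 0],
             vector [0, 0, \<rho>1\<^sup>2 * \<rho>2\<^sup>2 / (\<rho>1\<^sup>2 + \<rho>2\<^sup>2)]])"

text \<open>The gauge potential: \<open>gauge q $ \<mu>\<close> is the vector \<open>A\<^sub>\<mu>\<close>.\<close>

definition gauge :: "real ^ 3 \<Rightarrow> real ^ 3 ^ 3" where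
  "gauge q = vector [0, 0, vector [0, 0, (q $ 2)\<^sup>2 / ((q $ 1)\<^sup>2 + (q $ 2)\<^sup>2)]]"

definition hamiltonian ::
    "real ^ 3 \<Rightarrow> real ^ 3 \<Rightarrow> real ^ 3 \<Rightarrow> real ^ 3 \<Rightarrow> real ^ 3 \<Rightarrow> real" where
  "hamiltonian m \<alpha> q p J =
     1 / 2 * (J \<bullet> (matrix_inv (inertia q) *v J))
     + 1 / 2 * (\<Sum>\<mu>\<in>UNIV. \<Sum>\<nu>\<in>UNIV. matrix_inv (metric q) $ \<mu> $ \<nu>
         * (p $ \<mu> - J \<bullet> gauge q $ \<mu>) * (p $ \<nu> - J \<bullet> gauge q $ \<nu>))
     + potential m \<alpha> q"

definition dilation :: "real \<Rightarrow> real ^ 3 \<Rightarrow> real ^ 3" where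
  "dilation l q = vector [l * q $ 1, l * q $ 2, q $ 3]"

definition shape_space :: "(real ^ 3) set" where
  "shape_space = {q \<in> internal_space. (q $ 1)\<^sup>2 + (q $ 2)\<^sup>2 = 1}"

definition hill_region ::
    "real ^ 3 \<Rightarrow> real ^ 3 \<Rightarrow> real \<Rightarrow> real \<Rightarrow> ((real ^ 3) \<times> (real ^ 3)) set" where
  "hill_region m \<alpha> E r =
     {(q, J) \<in> shape_space \<times> sphere 0 1.
        \<exists>l>0. \<exists>p. hamiltonian m \<alpha> (dilation l q) p (r *\<^sub>R J) = E}"

definition rotational_energy :: "real \<Rightarrow> real ^ 3 \<Rightarrow> real ^ 3 \<Rightarrow> real" where
  "rotational_energy r q J = r\<^sup>2 / 2 * (J \<bullet> (matrix_inv (inertia q) *v J))"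

text \<open>The polynomial \<open>F\<close> is taken with a complex argument because its roots may be non-real.\<close>

definition hill_poly ::
    "real ^ 3 \<Rightarrow> real ^ 3 \<Rightarrow> real \<Rightarrow> real \<Rightarrow> real ^ 3 \<Rightarrow> real ^ 3 \<Rightarrow> complex \<Rightarrow> complex" where
  "hill_poly m \<alpha> E r q J z =
     z\<^sup>2 * of_real E - of_real (r\<^sup>2 / 2 * (J \<bullet> (matrix_inv (inertia q) *v J)))
     - z * of_real (potential m \<alpha> q)"

definition hill_discr ::
    "real ^ 3 \<Rightarrow> real ^ 3 \<Rightarrow> real \<Rightarrow> real \<Rightarrow> real ^ 3 \<Rightarrow> real ^ 3 \<Rightarrow> real" where
  "hill_discr m \<alpha> E r q J = 4 * E * rotational_energy r q J + (potential m \<alpha> q)\<^sup>2"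

definition lambda_plus ::
    "real ^ 3 \<Rightarrow> real ^ 3 \<Rightarrow> real \<Rightarrow> real \<Rightarrow> real ^ 3 \<Rightarrow> real ^ 3 \<Rightarrow> complex" where
  "lambda_plus m \<alpha> E r q J =
     of_real (potential m \<alpha> q / (2 * E)) + csqrt (of_real (hill_discr m \<alpha> E r q J / (4 * E\<^sup>2)))"

definition lambda_minus ::
    "real ^ 3 \<Rightarrow> real ^ 3 \<Rightarrow> real \<Rightarrow> real \<Rightarrow> real ^ 3 \<Rightarrow> real ^ 3 \<Rightarrow> complex" where
  "lambda_minus m \<alpha> E r q J =
     of_real (potential m \<alpha> q / (2 * E)) - csqrt (of_real (hill_discr m \<alpha> E r q J / (4 * E\<^sup>2)))"


lemma norm_body1: "q \<in> internal_space \<Longrightarrow> norm (body1 q) = q $ 1"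
  by (simp add: internal_space_def body1_def norm_eq_sqrt_inner inner_vec_def sum_3)

lemma norm_body2: "q \<in> internal_space \<Longrightarrow> norm (body2 q) = q $ 2"
proof -
  assume q: "q \<in> internal_space"
  have "body2 q \<bullet> body2 q = (q $ 2)\<^sup>2 * ((cos (q $ 3))\<^sup>2 + (sin (q $ 3))\<^sup>2)"
    by (simp only: body2_def inner_vec_def sum_3 vector_3 distrib_left)
      (simp add: power2_eq_square ac_simps)
  then show ?thesis
    using q by (simp add: norm_eq_sqrt_inner internal_space_def)
qed

lemma inner_body: "body1 q \<bullet> body2 q = q $ 1 * q $ 2 * cos (q $ 3)"
  by (simp add: body1_def body2_def inner_vec_def sum_3)

lemma rotation_inner:
  fixes R :: "real ^ 3 ^ 3"
  assumes "rotation_matrix R"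
  shows "(R *v x) \<bullet> (R *v y) = x \<bullet> y"
  using assms
  by (metis orthogonal_transformation_def orthogonal_transformation_matrix matrix_of_matrix_vector_mul
      matrix_vector_mul_linear rotation_matrix_def)

lemma not_collinear_body:
  assumes "q \<in> internal_space"
  shows "\<not> collinear {0, body1 q, body2 q}"
proof
  assume "collinear {0, body1 q, body2 q}"
  then have "\<bar>body1 q \<bullet> body2 q\<bar> = norm (body1 q) * norm (body2 q)"
    by (simp add: norm_cauchy_schwarz_equal)
  then have "\<bar>cos (q $ 3)\<bar> = 1"
    using assms by (auto simp: norm_body1 norm_body2 inner_body internal_space_def abs_mult)
  then have "(cos (q $ 3))\<^sup>2 = 1"
    by (metis one_power2 power2_abs)
  then have "sin (q $ 3) = 0"
    using sin_cos_squared_add [of "q $ 3"] by simp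
  moreover have "sin (q $ 3) > 0"
    using assms by (auto simp: internal_space_def intro: sin_gt_zero)
  ultimately show False
    by simp
qed

lemma internal_space_orbits:
  fixes s1 s2 :: "real ^ 3"
  assumes "\<not> collinear {0, s1, s2}"
  shows "\<exists>!q. q \<in> internal_space \<and>
           (\<exists>R. rotation_matrix R \<and> R *v s1 = body1 q \<and> R *v s2 = body2 q)"
proof -
  have s1: "s1 \<noteq> 0"
    using assms by (auto simp: insert_commute)
  have s2: "s2 \<noteq> 0"
    using assms by (metis collinear_2 insert_absorb2 insert_commute)
  define c where "c = s1 \<bullet> s2 / (norm s1 * norm s2)"
  define q :: "real ^ 3" where "q = vector [norm s1, norm s2, arccos c]"
  have ne: "\<bar>s1 \<bullet> s2\<bar> \<noteq> norm s1 * norm s2"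
    using assms by (simp add: norm_cauchy_schwarz_equal)
  then have lt: "\<bar>s1 \<bullet> s2\<bar> < norm s1 * norm s2"
    using Cauchy_Schwarz_ineq2 [of s1 s2] by simp
  then have c: "\<bar>c\<bar> < 1"
    using s1 s2 by (simp add: c_def abs_mult)
  have q: "q \<in> internal_space"
    using c s1 s2 arccos_lt_bounded [of c] by (auto simp: q_def internal_space_def)
  have cosq: "cos (q $ 3) = c" "sin (q $ 3) = sqrt (1 - c\<^sup>2)"
    using c by (auto simp: q_def sin_arccos_abs)
  define e1 where "e1 = (1 / norm s1) *\<^sub>R s1"
  define d where "d = norm s2 * sqrt (1 - c\<^sup>2)"
  have c2: "c\<^sup>2 < 1"
    using c by (simp add: abs_square_less_1)
  have d: "d > 0"
    using c2 s2 by (simp add: d_def)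
  define e2 where "e2 = (1 / d) *\<^sub>R (s2 - (norm s2 * c) *\<^sub>R e1)"
  define e3 where "e3 = cross3 e1 e2"
  have s1e: "s1 = norm s1 *\<^sub>R e1"
    using s1 by (simp add: e1_def)
  have s2e: "s2 = (norm s2 * c) *\<^sub>R e1 + d *\<^sub>R e2"
    using d by (simp add: e2_def)
  have e11: "e1 \<bullet> e1 = 1"
    using s1 by (simp add: e1_def dot_square_norm power2_eq_square)
  have e1s2: "e1 \<bullet> s2 = norm s2 * c"
    using s1 s2 by (simp add: e1_def c_def)
  have e12: "e1 \<bullet> e2 = 0"
    by (simp add: e2_def inner_diff_right e1s2 e11)
  have "(s2 - (norm s2 * c) *\<^sub>R e1) \<bullet> (s2 - (norm s2 * c) *\<^sub>R e1) = (norm s2)\<^sup>2 - (norm s2 * c)\<^sup>2"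
    by (simp add: inner_diff_right inner_diff_left e1s2 e11 inner_commute [of s2 e1]
        power2_norm_eq_inner del: dot_square_norm, simp add: power2_eq_square)
  also have "\<dots> = d\<^sup>2"
    using c2 by (simp add: d_def power_mult_distrib algebra_simps)
  finally have e22: "e2 \<bullet> e2 = 1"
    using d by (simp add: e2_def power2_eq_square)
  have e13: "e1 \<bullet> e3 = 0" and e23: "e2 \<bullet> e3 = 0"
    by (simp_all add: e3_def dot_cross_self)
  have e33: "e3 \<bullet> e3 = 1"
    using norm_cross_dot [of e1 e2] e11 e22 e12
    by (simp add: e3_def dot_square_norm power_mult_distrib)
  define R :: "real ^ 3 ^ 3" where "R = vector [e1, e2, e3]"
  have Rv: "R *v x = vector [e1 \<bullet> x, e2 \<bullet> x, e3 \<bullet> x]" for x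
    by (simp add: vec_eq_iff matrix_vector_mul_component R_def forall_3)
  have Rs1: "R *v s1 = body1 q"
    unfolding Rv by (subst (1 2 3) s1e)
      (simp add: body1_def q_def e11 e12 e13 inner_commute [of e2 e1] inner_commute [of e3 e1])
  have Rs2: "R *v s2 = body2 q"
    unfolding Rv by (subst (1 2 3) s2e)
      (simp add: body2_def cosq d_def inner_add_right e11 e12 e13 e22 e23
        inner_commute [of e2 e1] inner_commute [of e3 e1] inner_commute [of e3 e2], simp add: q_def)
  have "orthogonal_matrix R"
    unfolding orthogonal_matrix_orthonormal_rows
    by (simp add: R_def row_def forall_3 orthogonal_def e12 e13 e23 e11 e22 e33 vec_lambda_eta
        norm_eq_1 inner_commute [of e2 e1] inner_commute [of e3 e1] inner_commute [of e3 e2])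
  moreover have "det R = e3 \<bullet> cross3 e1 e2"
    by (simp add: R_def dot_cross_det det_3 algebra_simps)
  ultimately have R: "rotation_matrix R"
    by (simp add: rotation_matrix_def e33 flip: e3_def)
  show ?thesis
  proof (rule ex1I [of _ q])
    show "q \<in> internal_space \<and>
      (\<exists>R. rotation_matrix R \<and> R *v s1 = body1 q \<and> R *v s2 = body2 q)"
      using q R Rs1 Rs2 by blast
  next
    fix q'
    assume "q' \<in> internal_space \<and>
      (\<exists>R. rotation_matrix R \<and> R *v s1 = body1 q' \<and> R *v s2 = body2 q')"
    then obtain R' where q': "q' \<in> internal_space" and R': "rotation_matrix R'"
      "R' *v s1 = body1 q'" "R' *v s2 = body2 q'"
      by blast
    have 1: "q' $ 1 = norm s1"
      using norm_body1 [OF q'] rotation_inner [OF R'(1), of s1 s1] R'(2)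
      by (simp add: norm_eq_sqrt_inner)
    have 2: "q' $ 2 = norm s2"
      using norm_body2 [OF q'] rotation_inner [OF R'(1), of s2 s2] R'(3)
      by (simp add: norm_eq_sqrt_inner)
    have "s1 \<bullet> s2 = q' $ 1 * q' $ 2 * cos (q' $ 3)"
      using inner_body [of q'] rotation_inner [OF R'(1), of s1 s2] R'(2,3) by simp
    then have "cos (q' $ 3) = c"
      using s1 s2 by (simp add: 1 2 c_def)
    then have "q' $ 3 = arccos c"
      using q' by (auto simp: internal_space_def arccos_cos)
    then show "q' = q"
      by (simp add: vec_eq_iff forall_3 q_def 1 2)
  qed
qed

lemma mutual_distances:
  fixes m x1 x2 x3 :: "real ^ 3"
  assumes m: "\<forall>i. m $ i > 0"
    and q: "q \<in> internal_space" and R: "rotation_matrix R"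
    and s1: "R *v jacobi1 m x1 x2 x3 = body1 q"
    and s2: "R *v jacobi2 m x1 x2 x3 = body2 q"
  shows "r12 m q = norm (x1 - x2)" "r13 m q = norm (x1 - x3)" "r23 m q = norm (x2 - x3)"
proof -
  have pos: "m $ 1 > 0" "m $ 2 > 0" "m $ 3 > 0"
    using m by auto
  have mu: "mu1 m > 0" "mu2 m > 0"
    using pos by (auto simp: mu1_def mu2_def)
  have nR: "norm (R *v x) = norm x" for x
    using rotation_inner [OF R, of x x] by (simp add: norm_eq_sqrt_inner)
  have b1: "(1 / sqrt (mu1 m)) *\<^sub>R body1 q = R *v (x1 - x3)"
    using mu by (simp flip: s1 add: jacobi1_def matrix_vector_mult_scaleR)
  have b2: "(1 / sqrt (mu2 m)) *\<^sub>R body2 q =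
      R *v (x2 - (1 / (m $ 1 + m $ 3)) *\<^sub>R (m $ 1 *\<^sub>R x1 + m $ 3 *\<^sub>R x3))"
    using mu by (simp flip: s2 add: jacobi2_def matrix_vector_mult_scaleR)
  show "r13 m q = norm (x1 - x3)"
  proof -
    have "norm ((1 / sqrt (mu1 m)) *\<^sub>R body1 q) = norm (x1 - x3)"
      by (simp only: b1 nR)
    then show ?thesis
      using mu by (simp add: r13_def norm_body1 [OF q])
  qed
  show "r12 m q = norm (x1 - x2)"
  proof -
    have "(x2 - (1 / (m $ 1 + m $ 3)) *\<^sub>R (m $ 1 *\<^sub>R x1 + m $ 3 *\<^sub>R x3))
        - (m $ 3 / (m $ 1 + m $ 3)) *\<^sub>R (x1 - x3) = x2 - x1"
      using pos by (simp add: vec_eq_iff add_pos_pos less_imp_neq [symmetric] divide_simps)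
        (simp add: algebra_simps)
    then have "r12 m q = norm (R *v (x2 - x1))"
      by (simp only: r12_def b1 b2 flip: matrix_vector_mult_scaleR matrix_vector_mult_diff_distrib)
    then show ?thesis
      by (simp only: nR norm_minus_commute)
  qed
  show "r23 m q = norm (x2 - x3)"
  proof -
    have "(x2 - (1 / (m $ 1 + m $ 3)) *\<^sub>R (m $ 1 *\<^sub>R x1 + m $ 3 *\<^sub>R x3))
        + (m $ 1 / (m $ 1 + m $ 3)) *\<^sub>R (x1 - x3) = x2 - x3"
      using pos by (simp add: vec_eq_iff add_pos_pos less_imp_neq [symmetric] divide_simps)
        (simp add: algebra_simps)
    then have "r23 m q = norm (R *v (x2 - x3))"
      by (simp only: r23_def b1 b2 flip: matrix_vector_mult_scaleR matrix_vector_right_distrib)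
    then show ?thesis
      by (simp only: nR)
  qed
qed

end

theory Submission
  imports Defs
begin

text \<open>
  The vibrational kinetic energy is a positive definite form in \<open>p\<close> shifted by the gauge term, so for
  fixed \<open>q\<close> and \<open>J\<close> it takes exactly the nonnegative values. Since \<open>M\<close> is homogeneous of degree \<open>2\<close>
  and \<open>V\<close> of degree \<open>-1\<close>, a shape-orientation point lies in the Hill region iff \<open>F(\<lambda>) \<ge> 0\<close> for some
  \<open>\<lambda> > 0\<close>. The claims then follow from the sign of \<open>F\<close> at large \<open>\<lambda>\<close> and at its vertex \<open>V / (2 E)\<close>,
  using \<open>E\<^sub>R > 0\<close>.
\<close>

section \<open>Inverses and quadratic forms of positive definite matrices\<close>

lemma matrix_inv_inverse:
  fixes A :: "real ^ 'n ^ 'n"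
  assumes "invertible A"
  shows "A ** matrix_inv A = mat 1" and "matrix_inv A ** A = mat 1"
  using assms someI_ex [of "\<lambda>B. A ** B = mat 1 \<and> B ** A = mat 1"]
  by (auto simp: invertible_def matrix_inv_def)

text \<open>A one-sided inverse of a square matrix is two-sided, so checking a single product
  identifies \<open>matrix_inv\<close>.\<close>

lemma matrix_inv_eqI:
  fixes A B :: "real ^ 'n ^ 'n"
  assumes "A ** B = mat 1"
  shows "matrix_inv A = B"
proof -
  have "invertible A"
    using assms invertible_right_inverse by blast
  then have "matrix_inv A ** (A ** B) = B"
    by (simp add: matrix_mul_assoc matrix_inv_inverse)
  then show ?thesis
    by (simp add: assms)
qed

lemma invertible_if_posdef:
  fixes A :: "real ^ 'n ^ 'n"
  assumes "\<And>w. w \<noteq> 0 \<Longrightarrow> w \<bullet> (A *v w) > 0"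
  shows "invertible A"
proof -
  have "\<forall>w. A *v w = 0 \<longrightarrow> w = 0"
    using assms by (metis inner_zero_right less_irrefl)
  then show ?thesis
    using invertible_left_inverse matrix_left_invertible_ker by blast
qed

text \<open>The substitution \<open>v = A *v w\<close> turns the form of the inverse at
  \<open>v\<close> into the form of \<open>A\<close> at \<open>w\<close>.\<close>

lemma posdef_matrix_inv:
  fixes A :: "real ^ 'n ^ 'n"
  assumes "\<And>w. w \<noteq> 0 \<Longrightarrow> w \<bullet> (A *v w) > 0" and "v \<noteq> 0"
  shows "v \<bullet> (matrix_inv A *v v) > 0"
proof -
  define w where "w = matrix_inv A *v v"
  have v: "A *v w = v"
    using invertible_if_posdef [OF assms(1)]
    by (simp add: w_def matrix_vector_mul_assoc matrix_inv_inverse)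
  then have "w \<noteq> 0"
    using \<open>v \<noteq> 0\<close> by auto
  then have "w \<bullet> v > 0"
    using assms(1) v by metis
  then show ?thesis
    by (simp add: w_def inner_commute)
qed

text \<open>The form is homogeneous of degree two, so rescaling one nonzero vector reaches every
  nonnegative value.\<close>

lemma posdef_form_attains:
  fixes A :: "real ^ 'n ^ 'n"
  assumes "\<And>w. w \<noteq> 0 \<Longrightarrow> w \<bullet> (A *v w) > 0" and "t \<ge> 0"
  shows "\<exists>v. v \<bullet> (A *v v) = t"
proof -
  obtain e :: "real ^ 'n" where "e \<noteq> 0"
    by (metis axis_eq_0_iff zero_neq_one)
  then have pos: "e \<bullet> (A *v e) > 0"
    by (rule assms(1))
  define c where "c = sqrt (t / (e \<bullet> (A *v e)))"
  have "c * c = t / (e \<bullet> (A *v e))"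
    using pos \<open>t \<ge> 0\<close> by (simp add: c_def)
  then have "(c *\<^sub>R e) \<bullet> (A *v (c *\<^sub>R e)) = t"
    using pos by (simp add: matrix_vector_mult_scaleR flip: mult.assoc)
  then show ?thesis ..
qed

lemma matrix_inv_scaleR:
  fixes A :: "real ^ 'n ^ 'n"
  assumes "invertible A" and "c \<noteq> 0"
  shows "matrix_inv (c *\<^sub>R A) = (1 / c) *\<^sub>R matrix_inv A"
  using assms
  by (intro matrix_inv_eqI)
    (simp add: matrix_scalar_ac matrix_inv_inverse flip: scalar_matrix_assoc)

text \<open>Links the double index sum in \<open>hamiltonian\<close> with the form to which the
  positivity lemmas apply.\<close>

lemma quadratic_form_eq_sum:
  fixes A :: "real ^ 'n ^ 'n"
  shows "v \<bullet> (A *v v) = (\<Sum>i\<in>UNIV. \<Sum>j\<in>UNIV. A $ i $ j * v $ i * v $ j)"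
  by (simp add: inner_vec_def matrix_vector_mult_def sum_distrib_left mult_ac)

section \<open>Positive definiteness of the inertia tensor and the metric\<close>

lemma inertia_posdef:
  assumes "q \<in> internal_space" and "w \<noteq> 0"
  shows "w \<bullet> (inertia q *v w) > 0"
proof -
  have q: "q $ 1 > 0" "q $ 2 > 0" "sin (q $ 3) > 0"
    using assms(1) by (auto simp: internal_space_def intro: sin_gt_zero)
  \<comment> \<open>Completing the square in the upper left block. Since
    \<open>sin (q $ 3) > 0\<close>, the three squares vanish together only at
    \<open>w = 0\<close>.\<close>
  have eq: "w \<bullet> (inertia q *v w) =
      (q $ 2 * (sin (q $ 3) * w $ 1 - cos (q $ 3) * w $ 2))\<^sup>2 + (q $ 1 * w $ 2)\<^sup>2
      + ((q $ 1)\<^sup>2 + (q $ 2)\<^sup>2) * (w $ 3)\<^sup>2" (is "_ = ?a\<^sup>2 + ?b\<^sup>2 + ?c * _")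
    by (simp add: inertia_def Let_def inner_vec_def sum_3 matrix_vector_mult_def
        power2_eq_square algebra_simps)
  have c: "?c > 0"
    using q by (simp add: add_pos_pos)
  show ?thesis
  proof (rule ccontr)
    assume "\<not> ?thesis"
    moreover have "?c * (w $ 3)\<^sup>2 \<ge> 0"
      using c by simp
    ultimately have "?a\<^sup>2 = 0" "?b\<^sup>2 = 0" "?c * (w $ 3)\<^sup>2 = 0"
      using zero_le_power2 [of ?a] zero_le_power2 [of ?b] unfolding eq by linarith+
    then have "w $ 1 = 0" "w $ 2 = 0" "w $ 3 = 0"
      using q c by auto
    then show False
      using assms(2) by (simp add: vec_eq_iff forall_3)
  qed
qed

lemma metric_posdef:
  assumes "q \<in> internal_space" and "w \<noteq> 0"
  shows "w \<bullet> (metric q *v w) > 0"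
proof -
  define c where "c = (q $ 1)\<^sup>2 * (q $ 2)\<^sup>2 / ((q $ 1)\<^sup>2 + (q $ 2)\<^sup>2)"
  have c: "c > 0"
    using assms(1) by (simp add: c_def internal_space_def add_pos_pos)
  have eq: "w \<bullet> (metric q *v w) = (w $ 1)\<^sup>2 + (w $ 2)\<^sup>2 + c * (w $ 3)\<^sup>2"
    by (simp add: metric_def Let_def c_def inner_vec_def sum_3 matrix_vector_mult_def
        power2_eq_square)
  show ?thesis
  proof (rule ccontr)
    assume "\<not> ?thesis"
    moreover have "c * (w $ 3)\<^sup>2 \<ge> 0"
      using c by simp
    ultimately have "(w $ 1)\<^sup>2 = 0" "(w $ 2)\<^sup>2 = 0" "c * (w $ 3)\<^sup>2 = 0"
      using zero_le_power2 [of "w $ 1"] zero_le_power2 [of "w $ 2"] unfolding eq by linarith+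
    then have "w $ 1 = 0" "w $ 2 = 0" "w $ 3 = 0"
      using c by auto
    then show False
      using assms(2) by (simp add: vec_eq_iff forall_3)
  qed
qed

section \<open>Scaling under dilations\<close>

lemma dilation_nth [simp]:
  "dilation l q $ 1 = l * q $ 1" "dilation l q $ 2 = l * q $ 2" "dilation l q $ 3 = q $ 3"
  by (simp_all add: dilation_def)

lemma dilation_internal_space:
  "l > 0 \<Longrightarrow> q \<in> internal_space \<Longrightarrow> dilation l q \<in> internal_space"
  by (simp add: internal_space_def)

lemma body_dilation:
  "body1 (dilation l q) = l *\<^sub>R body1 q" "body2 (dilation l q) = l *\<^sub>R body2 q"
  by (simp_all add: body1_def body2_def vec_eq_iff forall_3)

lemma distances_dilation:
  assumes "l > 0"
  shows "r12 m (dilation l q) = l * r12 m q"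
    and "r13 m (dilation l q) = l * r13 m q"
    and "r23 m (dilation l q) = l * r23 m q"
proof -
  have "a *\<^sub>R l *\<^sub>R x - b *\<^sub>R c *\<^sub>R l *\<^sub>R y = l *\<^sub>R (a *\<^sub>R x - b *\<^sub>R c *\<^sub>R y)"
    "a *\<^sub>R l *\<^sub>R x + b *\<^sub>R c *\<^sub>R l *\<^sub>R y = l *\<^sub>R (a *\<^sub>R x + b *\<^sub>R c *\<^sub>R y)"
    for a b c and x y :: "real ^ 3"
    by (simp_all add: vec_eq_iff algebra_simps)
  then show "r12 m (dilation l q) = l * r12 m q" "r23 m (dilation l q) = l * r23 m q"
    using assms by (simp_all only: r12_def r23_def body_dilation norm_scaleR abs_of_pos)
  show "r13 m (dilation l q) = l * r13 m q"
    by (simp add: r13_def)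
qed

text \<open>Each mutual distance has degree one. Should a distance vanish, the convention
  \<open>x / 0 = 0\<close> makes its term zero on both sides.\<close>

lemma potential_dilation:
  assumes "l > 0"
  shows "potential m \<alpha> (dilation l q) = potential m \<alpha> q / l"
  by (simp add: potential_def distances_dilation [OF assms] diff_divide_distrib mult.commute)

lemma inertia_dilation: "inertia (dilation l q) = l\<^sup>2 *\<^sub>R inertia q"
  by (simp add: inertia_def Let_def vec_eq_iff forall_3 power_mult_distrib algebra_simps)

lemma rotational_energy_pos:
  assumes "q \<in> internal_space" and "J \<noteq> 0" and "r > 0"
  shows "rotational_energy r q J > 0"
  using posdef_matrix_inv [OF inertia_posdef [OF assms(1)] assms(2)] assms(3)
  by (simp add: rotational_energy_def)

lemma rotational_energy_dilation:
  assumes "q \<in> internal_space" and "l > 0"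
  shows "1 / 2 * ((r *\<^sub>R J) \<bullet> (matrix_inv (inertia (dilation l q)) *v (r *\<^sub>R J)))
       = rotational_energy r q J / l\<^sup>2"
  using assms
  by (simp add: inertia_dilation matrix_inv_scaleR invertible_if_posdef inertia_posdef
      rotational_energy_def matrix_vector_mult_scaleR power2_eq_square
      flip: scaleR_matrix_vector_assoc)

section \<open>Elimination of the momenta and of the dilation factor\<close>

lemma ex_momentum_iff:
  assumes "q \<in> internal_space"
  shows "(\<exists>p. hamiltonian m \<alpha> q p J = E) \<longleftrightarrow>
         1 / 2 * (J \<bullet> (matrix_inv (inertia q) *v J)) + potential m \<alpha> q \<le> E"
proof -
  let ?G = "matrix_inv (metric q)"
  define U where "U = 1 / 2 * (J \<bullet> (matrix_inv (inertia q) *v J)) + potential m \<alpha> q"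
  \<comment> \<open>The gauge terms merely translate \<open>p\<close> by \<open>a\<close>, so
    \<open>p - a\<close> still ranges over all vectors.\<close>
  define a :: "real ^ 3" where "a = (\<chi> \<mu>. J \<bullet> gauge q $ \<mu>)"
  have H: "hamiltonian m \<alpha> q p J = 1 / 2 * ((p - a) \<bullet> (?G *v (p - a))) + U" for p
    by (simp add: hamiltonian_def quadratic_form_eq_sum a_def U_def)
  have pos: "v \<bullet> (?G *v v) > 0" if "v \<noteq> 0" for v
    using posdef_matrix_inv [OF metric_posdef [OF assms] that] .
  show ?thesis
    unfolding U_def [symmetric]
  proof
    assume "\<exists>p. hamiltonian m \<alpha> q p J = E"
    then obtain p where "hamiltonian m \<alpha> q p J = E" ..
    moreover have "(p - a) \<bullet> (?G *v (p - a)) \<ge> 0"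
      using pos [of "p - a"] by (cases "p - a = 0") auto
    ultimately show "U \<le> E"
      unfolding H by linarith
  next
    assume "U \<le> E"
    \<comment> \<open>\<open>E - U\<close> is the kinetic energy left for the vibration; the factor
      2 cancels the 1/2 in \<open>hamiltonian\<close>.\<close>
    then obtain v where "v \<bullet> (?G *v v) = 2 * (E - U)"
      using posdef_form_attains [OF pos, of "2 * (E - U)"] by auto
    then have "hamiltonian m \<alpha> q (v + a) J = E"
      by (simp add: H field_simps)
    then show "\<exists>p. hamiltonian m \<alpha> q p J = E" ..
  qed
qed

text \<open>After the momenta are eliminated, the energy inequality at \<open>dilation l q\<close>
  is multiplied by \<open>l\<^sup>2 > 0\<close>.\<close>

lemma hill_region_iff:
  assumes "q \<in> shape_space" and "J \<in> sphere 0 1"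
  shows "(q, J) \<in> hill_region m \<alpha> E r \<longleftrightarrow>
         (\<exists>l>0. l\<^sup>2 * E - rotational_energy r q J - l * potential m \<alpha> q \<ge> 0)"
proof -
  have q: "q \<in> internal_space"
    using assms(1) by (simp add: shape_space_def)
  have F: "(\<exists>p. hamiltonian m \<alpha> (dilation l q) p (r *\<^sub>R J) = E) \<longleftrightarrow>
        l\<^sup>2 * E - rotational_energy r q J - l * potential m \<alpha> q \<ge> 0" if l: "l > 0" for l
  proof -
    have "rotational_energy r q J / l\<^sup>2 + potential m \<alpha> q / l =
          (rotational_energy r q J + l * potential m \<alpha> q) / l\<^sup>2"
      using l by (simp add: add_divide_distrib power2_eq_square)
    then show ?thesis
      using l
      by (simp only: ex_momentum_iff [OF dilation_internal_space [OF l q]]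
          rotational_energy_dilation [OF q l] potential_dilation [OF l])
        (auto simp: pos_divide_le_eq mult.commute [of E])
  qed
  show ?thesis
    using assms by (simp add: hill_region_def F cong: conj_cong)
qed

section \<open>The complex roots and their reality\<close>

text \<open>The polynomial factors as \<open>E\<close> times the two linear factors. Only the square
  of \<open>s\<close> enters their product, so the sign of the discriminant does not matter.\<close>

lemma hill_poly_roots:
  assumes "E \<noteq> 0"
  shows "{z. hill_poly m \<alpha> E r q J z = 0} = {lambda_plus m \<alpha> E r q J, lambda_minus m \<alpha> E r q J}"
proof -
  define V where "V = potential m \<alpha> q"
  define R where "R = rotational_energy r q J"
  define s where "s = csqrt (of_real (hill_discr m \<alpha> E r q J / (4 * E\<^sup>2)))"
  have "s\<^sup>2 = of_real ((4 * E * R + V\<^sup>2) / (4 * E\<^sup>2))"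
    by (simp add: s_def hill_discr_def R_def V_def)
  also have "(4 * E * R + V\<^sup>2) / (4 * E\<^sup>2) = R / E + (V / (2 * E))\<^sup>2"
    using assms by (simp add: field_simps power2_eq_square)
  finally have s: "s\<^sup>2 = of_real (R / E + (V / (2 * E))\<^sup>2)" .
  have "hill_poly m \<alpha> E r q J z =
      of_real E * ((z - lambda_plus m \<alpha> E r q J) * (z - lambda_minus m \<alpha> E r q J))" for z
  proof -
    have "(z - lambda_plus m \<alpha> E r q J) * (z - lambda_minus m \<alpha> E r q J) =
        (z - of_real (V / (2 * E)))\<^sup>2 - s\<^sup>2"
      unfolding lambda_plus_def lambda_minus_def V_def [symmetric] s_def [symmetric]
      by (simp add: power2_eq_square algebra_simps add_divide_distrib)
    also have "of_real E * \<dots> = z\<^sup>2 * of_real E - of_real R - z * of_real V"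
      using assms unfolding s by (simp add: field_simps power2_eq_square)
    finally show ?thesis
      by (simp add: hill_poly_def R_def V_def rotational_energy_def)
  qed
  then show ?thesis
    using assms by auto
qed

text \<open>A real root exhibits \<open>x\<close> as the square of a real number; conversely
  \<open>csqrt\<close> of a nonnegative real is its real square root.\<close>

lemma csqrt_of_real_in_Reals_iff: "csqrt (of_real x) \<in> \<real> \<longleftrightarrow> x \<ge> 0"
proof
  assume "csqrt (of_real x) \<in> \<real>"
  then obtain y where "csqrt (of_real x) = of_real y"
    by (auto elim: Reals_cases)
  then have "(of_real x :: complex) = of_real (y\<^sup>2)"
    by (metis of_real_power power2_csqrt)
  then show "x \<ge> 0"
    by (simp only: of_real_eq_iff) simp
qed (simp add: csqrt_of_real_nonneg)

lemma lambda_real_iff: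
  assumes "E \<noteq> 0"
  shows "lambda_plus m \<alpha> E r q J \<in> \<real> \<longleftrightarrow> hill_discr m \<alpha> E r q J \<ge> 0"
    and "lambda_minus m \<alpha> E r q J \<in> \<real> \<longleftrightarrow> hill_discr m \<alpha> E r q J \<ge> 0"
proof -
  have "hill_discr m \<alpha> E r q J / (4 * E\<^sup>2) \<ge> 0 \<longleftrightarrow> hill_discr m \<alpha> E r q J \<ge> 0"
    using assms by (simp add: zero_le_divide_iff)
  moreover have "of_real a + w \<in> \<real> \<longleftrightarrow> w \<in> \<real>" "of_real a - w \<in> \<real> \<longleftrightarrow> w \<in> \<real>"
    for a :: real and w :: complex
    by (auto simp: complex_is_Real_iff)
  ultimately show "lambda_plus m \<alpha> E r q J \<in> \<real> \<longleftrightarrow> hill_discr m \<alpha> E r q J \<ge> 0"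
    "lambda_minus m \<alpha> E r q J \<in> \<real> \<longleftrightarrow> hill_discr m \<alpha> E r q J \<ge> 0"
    by (simp_all only: lambda_plus_def lambda_minus_def csqrt_of_real_in_Reals_iff)
qed

section \<open>Real quadratics on the positive half-line\<close>

lemma quadratic_nonneg_if_leading_pos:
  fixes a b c :: real
  assumes "a > 0"
  shows "\<exists>l>0. l\<^sup>2 * a - c - l * b \<ge> 0"
proof (intro exI conjI)
  \<comment> \<open>Chosen so that \<open>?l \<ge> 1\<close> and \<open>?l * a\<close> exceeds
    \<open>\<bar>b\<bar> + \<bar>c\<bar>\<close>; then
    \<open>?l * (?l * a - b) \<ge> ?l * a - b \<ge> c\<close>.\<close>
  let ?l = "1 + (\<bar>b\<bar> + \<bar>c\<bar>) / a"
  have l: "?l \<ge> 1"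
    using assms by simp
  have la: "?l * a = a + \<bar>b\<bar> + \<bar>c\<bar>"
    using assms by (simp add: field_simps)
  show "?l > 0"
    using l by linarith
  have "?l * (?l * a - b) \<ge> 1 * (?l * a - b)"
  proof (rule mult_right_mono [OF l])
    show "0 \<le> ?l * a - b"
      using assms la by linarith
  qed
  moreover have "?l * a - b \<ge> c"
    using assms la by linarith
  ultimately show "?l\<^sup>2 * a - c - ?l * b \<ge> 0"
    by (simp add: power2_eq_square right_diff_distrib mult.assoc)
qed

lemma quadratic_nonneg_iff_discr:
  fixes a b c :: real
  assumes "a < 0" and "b < 0"
  shows "(\<exists>l>0. l\<^sup>2 * a - c - l * b \<ge> 0) \<longleftrightarrow> 4 * a * c + b\<^sup>2 \<ge> 0"
proof
  assume "\<exists>l>0. l\<^sup>2 * a - c - l * b \<ge> 0"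
  then obtain l where "l\<^sup>2 * a - c - l * b \<ge> 0"
    by blast
  \<comment> \<open>Multiplying by \<open>4 * a < 0\<close> allows completing the square without
    division.\<close>
  then have "4 * a * (l\<^sup>2 * a - c - l * b) \<le> 0"
    using assms(1) by (simp add: mult_nonpos_nonneg)
  moreover have "4 * a * (l\<^sup>2 * a - c - l * b) = (2 * a * l - b)\<^sup>2 - (4 * a * c + b\<^sup>2)"
    by (simp add: power2_eq_square algebra_simps)
  ultimately show "4 * a * c + b\<^sup>2 \<ge> 0"
    using zero_le_power2 [of "2 * a * l - b"] by linarith
next
  assume "4 * a * c + b\<^sup>2 \<ge> 0"
  \<comment> \<open>The witness is the vertex \<open>b / (2 * a)\<close>, the maximum of the concave
    quadratic, positive because \<open>a\<close> and \<open>b\<close> are both negative.\<close>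
  moreover have "(b / (2 * a))\<^sup>2 * a - c - b / (2 * a) * b = - (4 * a * c + b\<^sup>2) / (4 * a)"
    using assms(1) by (simp add: field_simps power2_eq_square)
  ultimately have "(b / (2 * a))\<^sup>2 * a - c - b / (2 * a) * b \<ge> 0"
    using assms(1) by (simp add: divide_nonpos_neg)
  moreover have "b / (2 * a) > 0"
    using assms by (simp add: divide_neg_neg)
  ultimately show "\<exists>l>0. l\<^sup>2 * a - c - l * b \<ge> 0"
    by blast
qed

theorem theorem5p1:
  fixes m \<alpha> :: "real ^ 3" and E r :: real
  assumes "\<forall>i. m $ i > 0" and "r > 0" and "E \<noteq> 0"
  shows
    "(\<forall>q \<in> shape_space. \<forall>J \<in> sphere 0 1.
        {z. hill_poly m \<alpha> E r q J z = 0} = {lambda_plus m \<alpha> E r q J, lambda_minus m \<alpha> E r q J})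
   \<and> (E > 0 \<longrightarrow>
        (\<forall>q \<in> shape_space. \<forall>J \<in> sphere 0 1. (q, J) \<in> hill_region m \<alpha> E r))
   \<and> (E < 0 \<longrightarrow>
        (\<forall>q \<in> shape_space. potential m \<alpha> q > 0 \<longrightarrow>
          (\<forall>J \<in> sphere 0 1. (q, J) \<notin> hill_region m \<alpha> E r)))
   \<and> (E < 0 \<longrightarrow>
        (\<forall>q \<in> shape_space. \<forall>J \<in> sphere 0 1. potential m \<alpha> q < 0 \<longrightarrow>
          ((q, J) \<in> hill_region m \<alpha> E r \<longleftrightarrow>
             lambda_plus m \<alpha> E r q J \<in> \<real> \<and> lambda_minus m \<alpha> E r q J \<in> \<real>)))"
proof (intro conjI impI ballI)
  fix q J :: "real ^ 3"
  show "{z. hill_poly m \<alpha> E r q J z = 0} = {lambda_plus m \<alpha> E r q J, lambda_minus m \<alpha> E r q J}"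
    using \<open>E \<noteq> 0\<close> by (rule hill_poly_roots)
next
  fix q J :: "real ^ 3"
  assume "E > 0" "q \<in> shape_space" "J \<in> sphere 0 1"
  then show "(q, J) \<in> hill_region m \<alpha> E r"
    by (simp only: hill_region_iff quadratic_nonneg_if_leading_pos)
next
  fix q J :: "real ^ 3"
  assume E: "E < 0" and V: "potential m \<alpha> q > 0" and q: "q \<in> shape_space" and J: "J \<in> sphere 0 1"
  \<comment> \<open>For every \<open>l > 0\<close> all three terms of the polynomial are strictly
    negative.\<close>
  have "rotational_energy r q J > 0"
    using q J \<open>r > 0\<close> by (intro rotational_energy_pos) (auto simp: shape_space_def)
  moreover have "l\<^sup>2 * E < 0" "l * potential m \<alpha> q > 0" if "l > 0" for l
    using that E V by (simp_all add: mult_pos_neg)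
  ultimately show "(q, J) \<notin> hill_region m \<alpha> E r"
    unfolding hill_region_iff [OF q J] by (smt (verit))
next
  fix q J :: "real ^ 3"
  assume E: "E < 0" and V: "potential m \<alpha> q < 0" and q: "q \<in> shape_space" and J: "J \<in> sphere 0 1"
  show "(q, J) \<in> hill_region m \<alpha> E r \<longleftrightarrow>
      lambda_plus m \<alpha> E r q J \<in> \<real> \<and> lambda_minus m \<alpha> E r q J \<in> \<real>"
    \<comment> \<open>With \<open>a = E\<close>, \<open>b\<close> the potential and \<open>c\<close>
      the rotational energy, \<open>4 * a * c + b\<^sup>2\<close> is \<open>hill_discr\<close>,
      whose sign decides the reality of both roots at once.\<close>
    using quadratic_nonneg_iff_discr [OF E V, of "rotational_energy r q J"]
    by (simp only: hill_region_iff [OF q J] lambda_real_iff [OF \<open>E \<noteq> 0\<close>] hill_discr_def conj_absorb)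
qed

end
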